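(* For every $a\in\mathbb{C}$ with $4a+\tfrac12\notin\{0,-1,-2,\dots\}$, $$F\!\left(1-a,\tfrac12-a;4a+\tfrac12;\tfrac15\right)=\frac{2^{10a-5}\,\Gamma(\tfrac75)\,\Gamma(\tfrac85)\,\Gamma(4a+\tfrac12)}{5^{6a-3}\,\Gamma(\tfrac52)\,\Gamma(2a+\tfrac25)\,\Gamma(2a+\tfrac35)}.$$
   Context: $F(a,b;c;x)=\sum_{n\ge0}\frac{(a,n)(b,n)}{(c,n)(1,n)}x^n$ with $(\alpha,n)=\Gamma(\alpha+n)/\Gamma(\alpha)$ is the Gauss hypergeometric series. $1/\Gamma$ is interpreted as $0$ at the poles of $\Gamma$. *)

theory Defs
  imports "HOL-Analysis.Analysis"
begin

(* (alpha,n) = Gamma(alpha+n)/Gamma(alpha) is pochhammer alpha n (see pochhammer_Gamma).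
   At nonpositive integers alpha, where the quotient is undefined, pochhammer is its continuous
   extension, so the series terminates if a or b is a nonpositive integer. *)
definition gauss_F :: "complex \<Rightarrow> complex \<Rightarrow> complex \<Rightarrow> complex \<Rightarrow> complex" where
  "gauss_F a b c x =
     (\<Sum>n. (pochhammer a n * pochhammer b n) / (pochhammer c n * pochhammer 1 n) * x ^ n)"

end

theory Submission
  imports Defs "HOL-Complex_Analysis.Complex_Analysis"
begin

text \<open>
  Let \<open>S a\<close> be the series and \<open>R a\<close> the closed form. Creative telescoping yields a first-order
  recurrence for \<open>S\<close> (\<open>strange_F_recurrence\<close>), and by the functional equation of \<open>Gamma\<close> the
  closed form satisfies the same one (\<open>closed_form_recurrence\<close>). So \<open>S / R\<close> has period \<open>1\<close>, and
  since \<open>S 1 = R 1 = 1\<close> it remains to exclude a nonconstant periodic factor.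
  
  This is done by growth. On \<open>Re z > 1 / 10\<close> the quotient is holomorphic, hence it extends to a
  periodic entire function (\<open>periodic_half_plane_extension\<close>). Comparison with a binomial series
  bounds \<open>S\<close> by a multiple of \<open>exp (\<bar>Im z\<bar> / 4)\<close> on the strip \<open>1 \<le> Re z \<le> 2\<close>
  (\<open>norm_strange_F_le\<close>), and the exponential decays of the Gamma factors in \<open>1 / R\<close> cancel, so that
  \<open>1 / R\<close> is bounded by a multiple of \<open>exp \<bar>Im z\<bar>\<close> (\<open>norm_inverse_closed_form_le\<close>). A function
  of period \<open>1\<close> and exponential type less than \<open>pi\<close> is constant
  (\<open>periodic_entire_small_growth_constant\<close>), as in Carlson's theorem. The remaining values of
  \<open>a\<close>, to the left of the half-plane, are reached by running the recurrence backwards.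
\<close>

section \<open>Periodic entire functions of small exponential type\<close>

text \<open>
  Near a zero \<open>a\<close> of \<open>g\<close> the difference quotients of \<open>f\<close> and \<open>g\<close> at \<open>a\<close> extend
  holomorphically over \<open>a\<close>, the one of \<open>g\<close> with a nonzero value, so their quotient does too.
\<close>
lemma holomorphic_quotient_simple_zeros:
  fixes f g :: "complex \<Rightarrow> complex"
  assumes f: "f holomorphic_on UNIV" and g: "g holomorphic_on UNIV"
    and zeros: "\<And>z. g z = 0 \<Longrightarrow> f z = 0 \<and> deriv g z \<noteq> 0"
  shows "(\<lambda>z. if g z = 0 then deriv f z / deriv g z else f z / g z) holomorphic_on UNIV"
    (is "?q holomorphic_on _")
proof -
  have "\<exists>U. open U \<and> a \<in> U \<and> ?q holomorphic_on U" for a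
  proof (cases "g a = 0")
    case False
    define U where "U = - g -` {0}"
    have "open U"
      unfolding U_def
      by (intro open_Compl closed_vimage closed_singleton holomorphic_on_imp_continuous_on g)
    moreover have "?q holomorphic_on U"
    proof (rule holomorphic_transform)
      show "(\<lambda>z. f z / g z) holomorphic_on U"
        using f g by (intro holomorphic_on_divide) (auto simp: U_def intro: holomorphic_on_subset)
    qed (auto simp: U_def)
    ultimately show ?thesis using False by (auto simp: U_def)
  next
    case True
    define F where "F = (\<lambda>z. if z = a then deriv f a else (f z - f a) / (z - a))"
    define G where "G = (\<lambda>z. if z = a then deriv g a else (g z - g a) / (z - a))"
    have F: "F holomorphic_on UNIV" and G: "G holomorphic_on UNIV"
      unfolding F_def G_def by (intro pole_lemma_open f g open_UNIV)+
    define U where "U = - G -` {0}"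
    have U: "open U"
      unfolding U_def
      by (intro open_Compl closed_vimage closed_singleton holomorphic_on_imp_continuous_on G)
    have fa: "f a = 0" "deriv g a \<noteq> 0" using zeros[OF True] by auto
    have "?q holomorphic_on U"
    proof (rule holomorphic_transform)
      show "(\<lambda>z. F z / G z) holomorphic_on U"
        using F G by (intro holomorphic_on_divide) (auto simp: U_def intro: holomorphic_on_subset)
      show "F z / G z = ?q z" if "z \<in> U" for z
        using that fa True by (auto simp: F_def G_def U_def)
    qed
    moreover have "a \<in> U" using fa by (simp add: U_def G_def)
    ultimately show ?thesis using U by blast
  qed
  then show ?thesis
    by (meson UNIV_I holomorphic_on_def holomorphic_on_imp_differentiable_at field_differentiable_at_within)
qed

lemma norm_sin_lower_bound:
  fixes w :: complex
  assumes "\<bar>Im w\<bar> \<ge> 1"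
  shows "exp \<bar>Im w\<bar> / 4 \<le> norm (sin w)"
proof -
  have e2: "exp (- t) \<le> exp t / 2" if "t \<ge> 1" for t :: real
  proof -
    have "2 \<le> exp (2 * t)" using exp_ge_add_one_self[of "2 * t"] that by linarith
    then have "2 * exp (- t) \<le> exp (2 * t) * exp (- t)" by (intro mult_right_mono) auto
    then show ?thesis by (simp flip: exp_add)
  qed
  have "norm (exp (\<i> * w) - exp (- (\<i> * w))) \<ge> \<bar>exp (- Im w) - exp (Im w)\<bar>"
    using norm_triangle_ineq3[of "exp (\<i> * w)" "exp (- (\<i> * w))"] by simp
  moreover have "norm (sin w) = norm (exp (\<i> * w) - exp (- (\<i> * w))) / 2"
    by (simp add: sin_exp_eq norm_divide norm_mult)
  moreover have "\<bar>exp (- Im w) - exp (Im w)\<bar> \<ge> exp \<bar>Im w\<bar> / 2"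
    using e2[of "Im w"] e2[of "- Im w"] assms by (cases "Im w \<ge> 0") auto
  ultimately show ?thesis by linarith
qed

lemma periodic_of_int:
  fixes f :: "complex \<Rightarrow> 'a"
  assumes "\<And>z. f (z + 1) = f z"
  shows "f (z + of_int n) = f z"
proof -
  have nat: "f (z + of_nat k) = f z" for z k
  proof (induction k)
    case (Suc k)
    then show ?case using assms[of "z + of_nat k"] by (simp add: add_ac)
  qed simp
  show ?thesis
  proof (cases "n \<ge> 0")
    case True
    then show ?thesis using nat[of z "nat n"] by simp
  next
    case False
    then show ?thesis using nat[of "z + of_int n" "nat (- n)"] by simp
  qed
qed

text \<open>
  The function \<open>f - f 0\<close> vanishes at all integers by periodicity, so dividing it by
  \<open>sin (pi z)\<close> leaves an entire function \<open>q\<close>. As \<open>sin (pi z)\<close> grows like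
  \<open>exp (pi \<bar>Im z\<bar>)\<close>, faster than \<open>f\<close>, the function \<open>q\<close> is bounded and tends to \<open>0\<close> up
  the imaginary axis; by Liouville it is constant, hence zero.
\<close>
lemma periodic_entire_small_growth_constant:
  fixes f :: "complex \<Rightarrow> complex"
  assumes f: "f holomorphic_on UNIV" and per: "\<And>z. f (z + 1) = f z"
    and growth: "\<And>z. norm (f z) \<le> C * exp (c * \<bar>Im z\<bar>)" and c: "0 \<le> c" "c < pi"
  shows "f z = f 0"
proof -
  define h where "h = (\<lambda>z. f z - f 0)"
  define s where "s = (\<lambda>z::complex. sin (of_real pi * z))"
  define q where "q = (\<lambda>z. if s z = 0 then deriv h z / deriv s z else h z / s z)"
  define K where "K = C + norm (f 0)"
  have s_deriv: "deriv s z = of_real pi * cos (of_real pi * z)" for z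
    unfolding s_def by (rule DERIV_imp_deriv) (auto intro!: derivative_eq_intros)
  have h_per: "h (z + 1) = h z" for z by (simp add: h_def per)
  have s_per: "s (z + 1) = - s z" for z by (simp add: s_def ring_distribs sin_add)
  have s_zero: "h z = 0 \<and> deriv s z \<noteq> 0" if "s z = 0" for z
  proof
    from that obtain n :: int where "of_real pi * z = of_real (n * pi)"
      unfolding s_def sin_eq_0 by auto
    then have "z = of_int n" by (simp add: mult.commute)
    then show "h z = 0" using periodic_of_int[of h 0 n] h_per by (simp add: h_def)
    show "deriv s z \<noteq> 0"
      using that sin_cos_squared_add[of "of_real pi * z"] unfolding s_deriv by (auto simp: s_def)
  qed
  have "q holomorphic_on UNIV"
    unfolding q_def
  proof (rule holomorphic_quotient_simple_zeros)
    show "h holomorphic_on UNIV" "s holomorphic_on UNIV"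
      using f by (auto simp: h_def s_def intro!: holomorphic_intros)
  qed (use s_zero in auto)
  have q_per: "q (z + 1) = - q z" for z
  proof -
    have "deriv h (z + 1) = deriv (\<lambda>w. h (w + 1)) z"
      unfolding deriv_def DERIV_shift ..
    then have "deriv h (z + 1) = deriv h z" by (simp add: h_per)
    then show ?thesis
      by (simp add: q_def s_per h_per s_deriv ring_distribs cos_add)
  qed
  then have norm_q_per: "norm (q (z + of_int n)) = norm (q z)" for z n
    by (intro periodic_of_int[where f = "\<lambda>z. norm (q z)"]) simp
  \<comment> \<open>Height \<open>1\<close> is enough to be away from the real zeros of the sine, because \<open>pi \<ge> 1\<close>.\<close>
  have far: "norm (q z) \<le> 4 * K * exp ((c - pi) * \<bar>Im z\<bar>)" if z: "\<bar>Im z\<bar> \<ge> 1" for z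
  proof -
    have "1 * 1 \<le> pi * \<bar>Im z\<bar>" using z pi_gt3 by (intro mult_mono) auto
    then have s: "exp (pi * \<bar>Im z\<bar>) / 4 \<le> norm (s z)"
      using norm_sin_lower_bound[of "of_real pi * z"] by (simp add: s_def abs_mult)
    have "norm (h z) \<le> C * exp (c * \<bar>Im z\<bar>) + norm (f 0) * 1"
      unfolding h_def using norm_triangle_ineq4[of "f z" "f 0"] growth[of z] by simp
    also have "\<dots> \<le> C * exp (c * \<bar>Im z\<bar>) + norm (f 0) * exp (c * \<bar>Im z\<bar>)"
      using c by (intro add_left_mono mult_left_mono) auto
    finally have h: "norm (h z) \<le> K * exp (c * \<bar>Im z\<bar>)" by (simp add: K_def algebra_simps)
    have "s z \<noteq> 0" using s by (metis exp_gt_zero norm_zero not_le zero_less_divide_iff zero_less_numeral)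
    then have "norm (q z) = norm (h z) / norm (s z)" by (simp add: q_def norm_divide)
    also have "\<dots> \<le> K * exp (c * \<bar>Im z\<bar>) / (exp (pi * \<bar>Im z\<bar>) / 4)"
      using h s by (intro frac_le) (auto intro: order_trans[OF norm_ge_zero])
    also have "\<dots> = 4 * K * exp ((c - pi) * \<bar>Im z\<bar>)"
      by (simp add: left_diff_distrib exp_diff)
    finally show ?thesis .
  qed
  have "C \<ge> 0" using growth[of 0] by (auto intro: order_trans[OF norm_ge_zero])
  then have K: "K \<ge> 0" by (simp add: K_def)
  have "compact (q ` cbox (Complex 0 (-1)) (Complex 1 1))"
    using \<open>q holomorphic_on UNIV\<close>
    by (auto intro!: compact_continuous_image holomorphic_on_imp_continuous_on
        intro: holomorphic_on_subset)
  then obtain B where B: "\<And>z. z \<in> cbox (Complex 0 (-1)) (Complex 1 1) \<Longrightarrow> norm (q z) \<le> B"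
    using compact_imp_bounded bounded_iff by (metis (no_types, lifting) image_eqI)
  have "norm (q z) \<le> max B (4 * K)" for z
  proof (cases "\<bar>Im z\<bar> \<ge> 1")
    case True
    have "4 * K * exp ((c - pi) * \<bar>Im z\<bar>) \<le> 4 * K * 1"
      using K c by (intro mult_left_mono) (auto simp: mult_nonpos_nonneg)
    then show ?thesis using far[OF True] by simp
  next
    case False
    \<comment> \<open>Points near the real axis are moved into a compact fundamental rectangle.\<close>
    define w where "w = z + of_int (- \<lfloor>Re z\<rfloor>)"
    have "w \<in> cbox (Complex 0 (-1)) (Complex 1 1)"
      using False by (auto simp: w_def in_cbox_complex_iff) linarith+
    then have "norm (q w) \<le> B" by (rule B)
    then show ?thesis using norm_q_per[of z "- \<lfloor>Re z\<rfloor>"] by (simp add: w_def)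
  qed
  then have "bounded (range q)" by (auto simp: bounded_iff)
  then have "q constant_on UNIV" by (rule Liouville_theorem[OF \<open>q holomorphic_on UNIV\<close>])
  then obtain k where k: "\<And>z. q z = k" by (auto simp: constant_on_def)
  have lim: "((\<lambda>t::real. 4 * K * exp ((c - pi) * t)) \<longlongrightarrow> 4 * K * 0) at_top"
  proof (intro tendsto_intros)
    have "filterlim (\<lambda>t. (c - pi) * t) at_bot at_top"
      using c by (intro filterlim_tendsto_neg_mult_at_bot[OF tendsto_const] filterlim_ident) auto
    then show "((\<lambda>t. exp ((c - pi) * t)) \<longlongrightarrow> 0) at_top"
      by (rule filterlim_compose[OF exp_at_bot])
  qed
  have "norm k \<le> 4 * K * 0"
  proof (rule tendsto_lowerbound[OF lim])
    show "\<forall>\<^sub>F t in at_top. norm k \<le> 4 * K * exp ((c - pi) * t)"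
      using eventually_ge_at_top[of "1::real"]
    proof eventually_elim
      case (elim t)
      then show ?case using far[of "Complex 0 t"] by (simp add: k)
    qed
  qed simp
  then have "k = 0" by simp
  have "h z = 0"
    using s_zero[of z] k[of z] \<open>k = 0\<close> by (cases "s z = 0") (auto simp: q_def)
  then show ?thesis by (simp add: h_def)
qed

text \<open>
  The value \<open>f (z + n)\<close> does not depend on \<open>n\<close> once \<open>z + n\<close> lies in the half-plane. The
  extension takes this common value, and near a given point one fixed \<open>n\<close> computes it.
\<close>
lemma periodic_half_plane_extension:
  fixes f :: "complex \<Rightarrow> complex"
  assumes f: "f holomorphic_on {z. Re z > c}" and per: "\<And>z. Re z > c \<Longrightarrow> f (z + 1) = f z"
  obtains g where "g holomorphic_on UNIV" "\<And>z. g (z + 1) = g z" "\<And>z. Re z > c \<Longrightarrow> g z = f z"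
proof
  define k where "k = (\<lambda>z. nat \<lceil>c + 1 - Re z\<rceil>)"
  define g where "g = (\<lambda>z. f (z + of_nat (k z)))"
  have shift: "f (z + of_nat n) = f z" if "Re z > c" for z n
  proof (induction n)
    case (Suc n)
    then show ?case using per[of "z + of_nat n"] that by (simp add: add_ac)
  qed simp
  have g: "g z = f (z + of_nat n)" if n: "Re z + real n > c" for z n
  proof -
    have k: "Re z + real (k z) > c" unfolding k_def by linarith
    have "f (z + of_nat (k z)) = f (z + of_nat (k z) + of_nat n)"
      using k by (intro shift[symmetric]) simp
    also have "\<dots> = f (z + of_nat n + of_nat (k z))" by (simp add: add_ac)
    also have "\<dots> = f (z + of_nat n)" using n by (intro shift) simp
    finally show ?thesis by (simp add: g_def)
  qed
  show "g z = f z" if "Re z > c" for z using g[of z 0] that by simp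
  show "g (z + 1) = g z" for z
  proof -
    have k: "Re z + real (k z) > c" unfolding k_def by linarith
    show ?thesis using g[of z "Suc (k z)"] g[of "z + 1" "k z"] k by (simp add: add_ac)
  qed
  show "g holomorphic_on UNIV"
  proof -
    have "g field_differentiable at a" for a
    proof -
      define U where "U = {z. Re z > Re a - 1}"
      define n where "n = nat \<lceil>c + 2 - Re a\<rceil>"
      have n: "Re z + real n > c" if "z \<in> U" for z using that by (simp add: U_def n_def) linarith
      have "f \<circ> (\<lambda>z. z + of_nat n) holomorphic_on U"
        by (rule holomorphic_on_compose_gen[OF _ f]) (use n in \<open>auto intro!: holomorphic_intros\<close>)
      then have "g holomorphic_on U"
        by (rule holomorphic_transform) (use g[OF n] in auto)
      moreover have "open U" "a \<in> U" unfolding U_def by (auto intro: open_halfspace_Re_gt)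
      ultimately show ?thesis by (rule holomorphic_on_imp_differentiable_at)
    qed
    then show ?thesis by (simp add: holomorphic_on_def)
  qed
qed

section \<open>Comparing Gamma on a horizontal line\<close>

text \<open>
  The decay of \<open>Gamma\<close> in the imaginary direction is controlled here without Stirling's formula:
  only ratios of Gamma values at equal height are needed. In Euler's limit formula the factors of
  such a ratio are \<open>norm (w + k) / norm (z + k)\<close>, and adding the same square
  \<open>(Im z)\<^sup>2\<close> to the squares of \<open>Re w + k\<close> and \<open>Re z + k\<close> moves their quotient towards \<open>1\<close>.
\<close>
lemma norm_Gamma_ratio_le:
  fixes z w :: complex
  assumes "Re z > 0" "Re z \<le> Re w" "Im z = Im w"
  shows "norm (Gamma z) * Gamma (Re w) \<le> Gamma (Re z) * norm (Gamma w)"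
proof (rule LIMSEQ_le)
  show "(\<lambda>n. norm (Gamma_series z n) * Gamma_series (Re w) n) \<longlonglongrightarrow> norm (Gamma z) * Gamma (Re w)"
    by (intro tendsto_intros)
  show "(\<lambda>n. Gamma_series (Re z) n * norm (Gamma_series w n)) \<longlonglongrightarrow> Gamma (Re z) * norm (Gamma w)"
    by (intro tendsto_intros)
  have factor: "norm (w + of_nat k) * (Re z + real k) \<le> norm (z + of_nat k) * (Re w + real k)" for k
  proof (rule power2_le_imp_le)
    have "(Re z + k)\<^sup>2 \<le> (Re w + k)\<^sup>2" using assms by (intro power_mono) auto
    then have "(Im w)\<^sup>2 * (Re z + k)\<^sup>2 \<le> (Im w)\<^sup>2 * (Re w + k)\<^sup>2"
      by (intro mult_left_mono) auto
    then show "(norm (w + of_nat k) * (Re z + real k))\<^sup>2 \<le> (norm (z + of_nat k) * (Re w + real k))\<^sup>2"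
      using assms unfolding power_mult_distrib cmod_power2 by (simp add: algebra_simps)
  qed (use assms in auto)
  have poch: "norm (pochhammer w n) * pochhammer (Re z) n \<le> norm (pochhammer z n) * pochhammer (Re w) n" for n
    unfolding pochhammer_prod prod_norm[symmetric] prod.distrib[symmetric]
    by (intro prod_mono) (use assms factor in \<open>auto simp: add_ac\<close>)
  have "norm (Gamma_series z n) * Gamma_series (Re w) n \<le> Gamma_series (Re z) n * norm (Gamma_series w n)" for n
  proof -
    have [simp]: "pochhammer (Re z) m > 0" "pochhammer (Re w) m > 0" for m
      using assms by (auto intro!: pochhammer_pos)
    have "pochhammer z m \<noteq> 0" "pochhammer w m \<noteq> 0" for m
      using assms by (auto simp: pochhammer_eq_0_iff)
    then have "norm (pochhammer z (n+1)) > 0" "norm (pochhammer w (n+1)) > 0" by auto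
    moreover have "norm (exp (u * complex_of_real (ln (real n)))) = exp (Re u * ln (real n))" for u
      by simp
    ultimately show ?thesis
      using poch[of "n+1"] unfolding Gamma_series_def norm_divide norm_mult
      by (simp add: divide_simps mult_ac del: pochhammer_Suc)
  qed
  then show "\<exists>N. \<forall>n\<ge>N. norm (Gamma_series z n) * Gamma_series (Re w) n
      \<le> Gamma_series (Re z) n * norm (Gamma_series w n)" by blast
qed

section \<open>A first-order recurrence for the series\<close>
lemma tendsto_shift_ratio:
  fixes u v :: complex
  shows "(\<lambda>n. (u + of_nat n) / (v + of_nat n)) \<longlonglongrightarrow> 1"
proof -
  have inf: "filterlim (\<lambda>n. v + of_nat n) at_infinity sequentially"
    by (rule tendsto_add_filterlim_at_infinity[OF tendsto_const tendsto_of_nat])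
  then have "(\<lambda>n. 1 + (u - v) / (v + of_nat n)) \<longlonglongrightarrow> 1 + 0"
    by (intro tendsto_add tendsto_const tendsto_divide_0[OF tendsto_const])
  moreover have "\<forall>\<^sub>F n in sequentially. 1 + (u - v) / (v + of_nat n) = (u + of_nat n) / (v + of_nat n)"
    using filterlim_at_infinity_imp_eventually_ne[OF inf, of 0]
    by eventually_elim (simp add: field_simps)
  ultimately show ?thesis by (simp add: Lim_transform_eventually)
qed

lemma summable_gauss_F:
  fixes a b c x :: complex
  assumes c: "c \<notin> \<int>\<^sub>\<le>\<^sub>0" and x: "norm x < 1"
  shows "summable (\<lambda>n. (pochhammer a n * pochhammer b n) / (pochhammer c n * pochhammer 1 n) * x ^ n)"
    (is "summable ?t")
proof -
  define r where "r = (\<lambda>n. (a + of_nat n) / (c + of_nat n) * ((b + of_nat n) / (1 + of_nat n)) * x)"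
  have step: "?t (Suc n) = r n * ?t n" for n
    unfolding r_def pochhammer_Suc power_Suc times_divide_times_eq times_divide_eq_left times_divide_eq_right
    by (simp add: mult_ac)
  have "(\<lambda>n. norm (r n)) \<longlonglongrightarrow> norm (1 * 1 * x)"
    unfolding r_def by (intro tendsto_intros tendsto_shift_ratio)
  then have "\<forall>\<^sub>F n in sequentially. norm (r n) < (1 + norm x) / 2"
    by (rule order_tendstoD) (use x in auto)
  then obtain N where N: "\<And>n. n \<ge> N \<Longrightarrow> norm (r n) < (1 + norm x) / 2"
    by (auto simp: eventually_sequentially)
  show ?thesis
  proof (rule summable_ratio_test)
    show "(1 + norm x) / 2 < 1" using x by simp
    show "norm (?t (Suc n)) \<le> (1 + norm x) / 2 * norm (?t n)" if "n \<ge> N" for n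
      unfolding step norm_mult[of "r n"] using N[OF that] by (intro mult_right_mono) auto
  qed
qed

definition strange_term :: "complex \<Rightarrow> nat \<Rightarrow> complex" where
  "strange_term a n = (pochhammer (1 - a) n * pochhammer (1 / 2 - a) n) /
     (pochhammer (4 * a + 1 / 2) n * pochhammer 1 n) * (1 / 5) ^ n"

definition strange_F :: "complex \<Rightarrow> complex" where
  "strange_F a = gauss_F (1 - a) (1 / 2 - a) (4 * a + 1 / 2) (1 / 5)"

lemma strange_term_sums:
  assumes "4 * a + 1 / 2 \<notin> \<int>\<^sub>\<le>\<^sub>0"
  shows "strange_term a sums strange_F a"
  unfolding strange_F_def gauss_F_def strange_term_def
  using summable_gauss_F[OF assms, of "1 / 5" "1 - a" "1 / 2 - a"] by (intro summable_sums) auto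

text \<open>
  Zeilberger's creative telescoping looks for a rational multiple of the summand of
  \<open>strange_F a\<close> whose difference in the summation index is the summand of a linear relation between
  \<open>strange_F (a + 1)\<close> and \<open>strange_F a\<close>. This is the polynomial in its numerator. Its degree \<open>4\<close>
  in \<open>m\<close> is forced by comparing leading terms in \<open>certificate_identity\<close>, and the coefficients
  follow by solving that identity from the top degree downwards.
\<close>
definition certificate :: "complex \<Rightarrow> complex \<Rightarrow> complex" where
  "certificate a m = 1280 * m ^ 4 + (5120 + 10880 * a) * m ^ 3
     + (4480 + 21440 * a + 23680 * a\<^sup>2) * m\<^sup>2
     - (1280 + 7760 * a + 20240 * a\<^sup>2 + 25120 * a ^ 3) * m
     - (1200 + 12620 * a + 52220 * a\<^sup>2 + 96320 * a ^ 3 + 60720 * a ^ 4)"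

text \<open>
  Together with \<open>pochhammer (4 * a + 1 / 2) 4\<close> this is what the functional equation of \<open>Gamma\<close>
  produces when \<open>a\<close> is raised by \<open>1\<close> in the closed form.
\<close>
definition shift_factor :: "complex \<Rightarrow> complex" where
  "shift_factor a = pochhammer (2 * a + 2 / 5) 2 * pochhammer (2 * a + 3 / 5) 2"

lemma pochhammer_4: "pochhammer x 4 = x * (x + 1) * (x + 2) * (x + 3 :: 'a :: comm_semiring_1)"
  by (simp add: eval_nat_numeral pochhammer_Suc add_ac)

lemma pochhammer_2: "pochhammer x 2 = x * (x + 1 :: 'a :: comm_semiring_1)"
  by (simp add: eval_nat_numeral pochhammer_Suc add_ac)

lemma certificate_identity:
  fixes a m :: complex
  defines "x \<equiv> 4 * a + 1 / 2 + m"
  shows "certificate a m * m * (x + 3) + 5 ^ 6 * shift_factor a * (a * (a + 1 / 2))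
     - 2 ^ 10 * ((m - a) * (m - 1 / 2 - a)) * pochhammer x 4
     = certificate a (m + 1) * ((m - a) * (m - 1 / 2 - a)) / 5"
  unfolding x_def certificate_def shift_factor_def pochhammer_2 pochhammer_4
  by (simp add: field_simps) algebra

lemma certificate_1:
  "certificate a 1 = 5 * (5 ^ 6 * shift_factor a - 2 ^ 10 * pochhammer (4 * a + 1 / 2) 4)"
  unfolding certificate_def shift_factor_def pochhammer_2 pochhammer_4
  by (simp add: field_simps) algebra

lemma strange_term_Suc:
  "strange_term a (Suc n) = strange_term a n *
     ((of_nat (Suc n) - a) * (of_nat (Suc n) - 1 / 2 - a)) / ((4 * a + 1 / 2 + of_nat n) * of_nat (Suc n) * 5)"
proof -
  have "1 - a + of_nat n = of_nat (Suc n) - a" "1 / 2 - a + of_nat n = of_nat (Suc n) - 1 / 2 - a"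
    "1 + of_nat n = (of_nat (Suc n) :: complex)" by (simp_all add: field_simps)
  then show ?thesis
    unfolding strange_term_def pochhammer_Suc power_Suc by (simp only:) (simp add: mult_ac del: of_nat_Suc)
qed

text \<open>
  The index is shifted by one because \<open>pochhammer (- a) (Suc n) = - a * pochhammer (1 - a) n\<close>
  holds without a division: expressing \<open>strange_term (a + 1) n\<close> by \<open>strange_term a n\<close> would
  divide by \<open>n - a\<close> and \<open>n - 1 / 2 - a\<close>, which vanish when the series terminates.
\<close>
lemma strange_term_plus1_Suc:
  assumes "4 * a + 1 / 2 \<notin> \<int>\<^sub>\<le>\<^sub>0"
  shows "strange_term (a + 1) (Suc n) / pochhammer (4 * a + 1 / 2) 4 = strange_term a n *
     (a * (a + 1 / 2)) / ((4 * a + 1 / 2 + of_nat n) * pochhammer (4 * a + 1 / 2 + of_nat (Suc n)) 4 * of_nat (Suc n) * 5)"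
proof -
  define c where "c = 4 * a + 1 / 2"
  have nz: "pochhammer c k \<noteq> 0" for k
    using assms pochhammer_eq_0_imp_nonpos_Int[of c k] by (auto simp: c_def)
  have "pochhammer c (4 + Suc n) = pochhammer c 4 * pochhammer (c + 4) (Suc n)"
    using pochhammer_product'[of c 4 "Suc n"] by simp
  moreover have "pochhammer c (Suc n + 4) = pochhammer c n * (c + of_nat n) * pochhammer (c + of_nat (Suc n)) 4"
    using pochhammer_product'[of c "Suc n" 4] by (simp add: pochhammer_Suc)
  ultimately have prod: "pochhammer c 4 * pochhammer (c + 4) (Suc n)
      = pochhammer c n * (c + of_nat n) * pochhammer (c + of_nat (Suc n)) 4"
    by (simp add: add.commute)
  have "strange_term (a + 1) (Suc n) / pochhammer c 4
      = pochhammer (1 - a) n * pochhammer (1 / 2 - a) n * (a * (a + 1 / 2))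
        / ((pochhammer c 4 * pochhammer (c + 4) (Suc n)) * (pochhammer 1 n * of_nat (Suc n))) * (1 / 5) ^ Suc n"
  proof -
    have "pochhammer (- a) (Suc n) = - a * pochhammer (1 - a) n"
      "pochhammer (- 1 / 2 - a) (Suc n) = (- 1 / 2 - a) * pochhammer (1 / 2 - a) n"
      using pochhammer_rec[of "- a" n] pochhammer_rec[of "- 1 / 2 - a" n] by (simp_all add: algebra_simps)
    moreover have "1 - (a + 1) = - a" "1 / 2 - (a + 1) = - 1 / 2 - a" "4 * (a + 1) + 1 / 2 = c + 4"
      "pochhammer 1 (Suc n) = pochhammer 1 n * (of_nat (Suc n) :: complex)"
      by (simp_all add: c_def pochhammer_Suc)
    ultimately show ?thesis
      unfolding strange_term_def by (simp only:) (simp add: divide_simps, simp add: algebra_simps)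
  qed
  also have "\<dots> = strange_term a n * (a * (a + 1 / 2))
      / ((c + of_nat n) * pochhammer (c + of_nat (Suc n)) 4 * of_nat (Suc n) * 5)"
    unfolding prod strange_term_def c_def[symmetric] by (simp add: divide_simps)
  finally show ?thesis by (simp add: c_def)
qed

text \<open>
  Adding the summand of index \<open>Suc n\<close> to the right-hand side for \<open>n\<close> and clearing denominators is
  exactly \<open>certificate_identity\<close> at \<open>m = Suc n\<close>.
\<close>
lemma telescoped_sum:
  assumes c: "4 * a + 1 / 2 \<notin> \<int>\<^sub>\<le>\<^sub>0"
  shows "(\<Sum>k\<le>n. 5 ^ 6 * shift_factor a * (strange_term (a + 1) k / pochhammer (4 * a + 1 / 2) 4)
            - 2 ^ 10 * strange_term a k)
     = certificate a (of_nat (Suc n)) / (5 * pochhammer (4 * a + 1 / 2 + of_nat n) 4) * strange_term a n"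
proof (induction n)
  case 0
  have "pochhammer (4 * a + 1 / 2) 4 \<noteq> 0"
    using c pochhammer_eq_0_imp_nonpos_Int by blast
  then show ?case by (simp add: certificate_1 strange_term_def field_simps)
next
  case (Suc n)
  define m :: complex where "m = of_nat (Suc n)"
  define x where "x = 4 * a + 1 / 2 + m"
  define P where "P = (m - a) * (m - 1 / 2 - a)"
  have x: "4 * a + 1 / 2 + of_nat n = x - 1" by (simp add: x_def m_def)
  have nz: "x + of_nat k \<noteq> 0" for k
    using c plus_of_nat_eq_0_imp[of "4 * a + 1/2" "Suc n + k"]
    by (auto simp: x_def m_def add_ac)
  have nz': "x - 1 \<noteq> 0"
    using c plus_of_nat_eq_0_imp[of "4 * a + 1/2" "n"] by (auto simp: x_def m_def add_ac)
  have m: "m \<noteq> 0" unfolding m_def by (metis of_nat_eq_0_iff nat.distinct(2))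
  have p: "pochhammer (x - 1) 4 * (x + 3) = (x - 1) * pochhammer x 4"
    by (simp add: pochhammer_4 add_ac)
  have p0: "pochhammer x 4 \<noteq> 0" "x + 3 \<noteq> 0"
    using nz[of 0] nz[of 1] nz[of 2] nz[of 3] by (auto simp: pochhammer_4)
  have p1: "pochhammer (x - 1) 4 \<noteq> 0"
    using p p0 nz' by auto
  have "certificate a m / (5 * pochhammer (x - 1) 4)
      + 5 ^ 6 * shift_factor a * (a * (a + 1 / 2)) / ((x - 1) * pochhammer x 4 * m * 5)
      - 2 ^ 10 * P / ((x - 1) * m * 5)
      = (certificate a m * m * (x + 3) + 5 ^ 6 * shift_factor a * (a * (a + 1 / 2))
     - 2 ^ 10 * P * pochhammer x 4) / ((x - 1) * pochhammer x 4 * m * 5)"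
  proof -
    have "certificate a m / (5 * pochhammer (x - 1) 4)
      = certificate a m * m * (x + 3) / ((x - 1) * pochhammer x 4 * m * 5)"
      unfolding p[symmetric] using p0 p1 m by (subst frac_eq_eq) (auto simp: mult_ac)
    moreover have "2 ^ 10 * P / ((x - 1) * m * 5) = 2 ^ 10 * P * pochhammer x 4 / ((x - 1) * pochhammer x 4 * m * 5)"
      using p0 by (simp add: divide_simps)
    ultimately show ?thesis by (simp add: add_divide_distrib diff_divide_distrib)
  qed
  also have "\<dots> = certificate a (m + 1) / (5 * pochhammer x 4) * (P / ((x - 1) * m * 5))"
    unfolding x_def P_def certificate_identity by simp
  finally have key: "certificate a m / (5 * pochhammer (x - 1) 4)
      + 5 ^ 6 * shift_factor a * (a * (a + 1 / 2)) / ((x - 1) * pochhammer x 4 * m * 5)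
      - 2 ^ 10 * P / ((x - 1) * m * 5)
      = certificate a (m + 1) / (5 * pochhammer x 4) * (P / ((x - 1) * m * 5))" .
  have t1: "strange_term a (Suc n) = strange_term a n * (P / ((x - 1) * m * 5))"
    unfolding strange_term_Suc x by (simp add: m_def P_def)
  have t2: "strange_term (a + 1) (Suc n) / pochhammer (4 * a + 1 / 2) 4
      = strange_term a n * (a * (a + 1 / 2)) / ((x - 1) * pochhammer x 4 * m * 5)"
    unfolding strange_term_plus1_Suc[OF c] x by (simp add: m_def x_def)
  have m1: "of_nat (Suc (Suc n)) = m + 1" and x': "4 * a + 1 / 2 + of_nat (Suc n) = x"
    by (simp_all add: m_def x_def)
  have "(\<Sum>k\<le>Suc n. 5 ^ 6 * shift_factor a * (strange_term (a + 1) k / pochhammer (4 * a + 1 / 2) 4)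
            - 2 ^ 10 * strange_term a k)
    = strange_term a n * (certificate a m / (5 * pochhammer (x - 1) 4)
      + 5 ^ 6 * shift_factor a * (a * (a + 1 / 2)) / ((x - 1) * pochhammer x 4 * m * 5)
      - 2 ^ 10 * P / ((x - 1) * m * 5))"
    unfolding sum.atMost_Suc Suc.IH t1 t2 x m_def[symmetric] by (simp add: algebra_simps)
  then show ?case unfolding key t1 m1 x' by simp
qed

text \<open>
  Numerator and denominator have degree \<open>4\<close> in \<open>n\<close>, with leading coefficients \<open>1280\<close> and \<open>5\<close>.
  The limit makes the telescoped partial sums tend to \<open>0\<close>, since there the quotient is multiplied
  by the terms of a convergent series.
\<close>
lemma certificate_ratio_limit:
  "(\<lambda>n. certificate a (of_nat (Suc n)) / (5 * pochhammer (c + of_nat n) 4)) \<longlonglongrightarrow> 256"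
proof -
  define y :: "nat \<Rightarrow> complex" where "y = (\<lambda>n. inverse (of_nat (Suc n)))"
  have y: "y \<longlonglongrightarrow> 0" unfolding y_def
    by (rule filterlim_compose[OF tendsto_inverse_0] filterlim_compose[OF tendsto_of_nat filterlim_Suc])+
  define N where "N = (\<lambda>n. 1280 + (5120 + 10880 * a) * y n
     + (4480 + 21440 * a + 23680 * a\<^sup>2) * y n ^ 2
     - (1280 + 7760 * a + 20240 * a\<^sup>2 + 25120 * a ^ 3) * y n ^ 3
     - (1200 + 12620 * a + 52220 * a\<^sup>2 + 96320 * a ^ 3 + 60720 * a ^ 4) * y n ^ 4)"
  define M where "M = (\<lambda>n. (1 + (c - 1) * y n) * (1 + c * y n) * (1 + (c + 1) * y n) * (1 + (c + 2) * y n))"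
  have "(\<lambda>n. N n / (5 * M n)) \<longlonglongrightarrow> (1280 + (5120 + 10880 * a) * 0
     + (4480 + 21440 * a + 23680 * a\<^sup>2) * 0 ^ 2
     - (1280 + 7760 * a + 20240 * a\<^sup>2 + 25120 * a ^ 3) * 0 ^ 3
     - (1200 + 12620 * a + 52220 * a\<^sup>2 + 96320 * a ^ 3 + 60720 * a ^ 4) * 0 ^ 4) /
       (5 * ((1 + (c - 1) * 0) * (1 + c * 0) * (1 + (c + 1) * 0) * (1 + (c + 2) * 0)))"
    unfolding N_def M_def by (intro tendsto_intros y) auto
  moreover have "certificate a (of_nat (Suc n)) / (5 * pochhammer (c + of_nat n) 4) = N n / (5 * M n)" for n
  proof -
    define m :: complex where "m = of_nat (Suc n)"
    have m: "m \<noteq> 0" unfolding m_def by (metis of_nat_eq_0_iff nat.distinct(2))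
    have ym: "y n = inverse m" and n: "of_nat n = m - 1" by (simp_all add: y_def m_def)
    have "certificate a m = m ^ 4 * N n"
      using m by (simp add: certificate_def N_def ym field_simps eval_nat_numeral)
    moreover have "pochhammer (c + (m - 1)) 4 = m ^ 4 * M n"
    proof -
      have "c + (m - 1) = m * (1 + (c - 1) * y n)" "c + (m - 1) + 1 = m * (1 + c * y n)"
        "c + (m - 1) + 2 = m * (1 + (c + 1) * y n)" "c + (m - 1) + 3 = m * (1 + (c + 2) * y n)"
        using m by (simp_all add: ym field_simps)
      then show ?thesis unfolding pochhammer_4 M_def by (simp only: power4_eq_xxxx mult_ac)
    qed
    ultimately show ?thesis using m by (simp add: n m_def[symmetric])
  qed
  ultimately show ?thesis by simp
qed

lemma strange_F_recurrence:
  assumes c: "4 * a + 1 / 2 \<notin> \<int>\<^sub>\<le>\<^sub>0"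
  shows "5 ^ 6 * shift_factor a * strange_F (a + 1) = 2 ^ 10 * pochhammer (4 * a + 1 / 2) 4 * strange_F a"
proof -
  have c': "4 * (a + 1) + 1 / 2 \<notin> \<int>\<^sub>\<le>\<^sub>0"
    using c nonpos_Ints_diff_Nats[of "4 * (a + 1) + 1 / 2" 4] by (auto simp: algebra_simps)
  have p: "pochhammer (4 * a + 1 / 2) 4 \<noteq> 0"
    using c pochhammer_eq_0_imp_nonpos_Int by blast
  let ?f = "\<lambda>k. 5 ^ 6 * shift_factor a * (strange_term (a + 1) k / pochhammer (4 * a + 1 / 2) 4)
            - 2 ^ 10 * strange_term a k"
  have "(\<lambda>n. \<Sum>k\<le>n. ?f k) \<longlonglongrightarrow> 256 * 0"
    unfolding telescoped_sum[OF c]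
    using strange_term_sums[OF c]
    by (intro tendsto_mult certificate_ratio_limit summable_LIMSEQ_zero) (rule sums_summable)
  then have "?f sums 0" by (simp add: sums_def_le)
  moreover have "?f sums (5 ^ 6 * shift_factor a * (strange_F (a + 1) / pochhammer (4 * a + 1 / 2) 4)
            - 2 ^ 10 * strange_F a)"
    by (intro sums_diff sums_mult sums_divide strange_term_sums c c')
  ultimately have "5 ^ 6 * shift_factor a * (strange_F (a + 1) / pochhammer (4 * a + 1 / 2) 4)
            - 2 ^ 10 * strange_F a = 0"
    using sums_unique2 by blast
  then show ?thesis using p by (simp add: field_simps)
qed

section \<open>The closed form\<close>
definition closed_form :: "complex \<Rightarrow> complex" where
  "closed_form a = (2 powr (10 * a - 5) * Gamma (7 / 5) * Gamma (8 / 5) * Gamma (4 * a + 1 / 2)) /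
      (5 powr (6 * a - 3) * Gamma (5 / 2)) * rGamma (2 * a + 2 / 5) * rGamma (2 * a + 3 / 5)"

lemma closed_form_recurrence:
  assumes c: "4 * a + 1 / 2 \<notin> \<int>\<^sub>\<le>\<^sub>0"
  shows "5 ^ 6 * shift_factor a * closed_form (a + 1)
     = 2 ^ 10 * pochhammer (4 * a + 1 / 2) 4 * closed_form a"
proof -
  have "10 * (a + 1) - 5 = (10 * a - 5) + 10" "6 * (a + 1) - 3 = (6 * a - 3) + 6"
    by (simp_all add: algebra_simps)
  then have pow: "2 powr (10 * (a + 1) - 5) = 2 ^ 10 * 2 powr (10 * a - 5)"
    "5 powr (6 * (a + 1) - 3) = 5 ^ 6 * 5 powr (6 * a - 3)"
    by (simp_all only: powr_add) simp_all
  have G: "Gamma (4 * (a + 1) + 1 / 2) = pochhammer (4 * a + 1 / 2) 4 * Gamma (4 * a + 1 / 2)"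
    using pochhammer_Gamma[OF c, of 4] c by (simp add: Gamma_eq_zero_iff field_simps)
  have rG: "rGamma (2 * a + 2 / 5) = pochhammer (2 * a + 2 / 5) 2 * rGamma (2 * (a + 1) + 2 / 5)"
    "rGamma (2 * a + 3 / 5) = pochhammer (2 * a + 3 / 5) 2 * rGamma (2 * (a + 1) + 3 / 5)"
    using pochhammer_rGamma[of "2 * a + 2 / 5" 2] pochhammer_rGamma[of "2 * a + 3 / 5" 2]
    by (simp_all add: algebra_simps)
  have "(5 :: complex) ^ 6 \<noteq> 0" by simp
  then show ?thesis
    unfolding closed_form_def shift_factor_def pow G rG by (simp add: divide_simps)
qed

lemma Re_pos_not_nonpos_Int: "Re z > 0 \<Longrightarrow> z \<notin> \<int>\<^sub>\<le>\<^sub>0"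
  by (auto elim!: nonpos_Ints_cases)

lemma closed_form_nonzero:
  assumes "Re z > 1 / 10"
  shows "closed_form z \<noteq> 0"
  using assms unfolding closed_form_def
  by (simp add: Gamma_eq_zero_iff rGamma_eq_zero_iff Re_pos_not_nonpos_Int)

lemma closed_form_1: "closed_form 1 = 1"
proof -
  have nz: "Gamma (7 / 5) \<noteq> (0 :: complex)" "Gamma (8 / 5) \<noteq> (0 :: complex)" "Gamma (5 / 2) \<noteq> (0 :: complex)"
    by (auto simp: Gamma_eq_zero_iff intro!: Re_pos_not_nonpos_Int)
  have G: "Gamma (12 / 5) = 7 / 5 * (Gamma (7 / 5) :: complex)" "Gamma (13 / 5) = 8 / 5 * (Gamma (8 / 5) :: complex)"
    "Gamma (7 / 2) = 5 / 2 * (Gamma (5 / 2) :: complex)" "Gamma (9 / 2) = 7 / 2 * (Gamma (7 / 2) :: complex)"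
    using Gamma_plus1[of "7 / 5 :: complex"] Gamma_plus1[of "8 / 5 :: complex"]
      Gamma_plus1[of "5 / 2 :: complex"] Gamma_plus1[of "7 / 2 :: complex"]
    by (simp_all add: Re_pos_not_nonpos_Int)
  have "closed_form 1 = 2 ^ 5 * Gamma (7 / 5) * Gamma (8 / 5) * Gamma (9 / 2) / (5 ^ 3 * Gamma (5 / 2))
      * inverse (Gamma (12 / 5)) * inverse (Gamma (13 / 5))"
    by (simp add: closed_form_def rGamma_inverse_Gamma)
  also have "\<dots> = 1" unfolding G using nz by (simp add: divide_simps)
  finally show ?thesis .
qed

lemma strange_F_1: "strange_F 1 = 1"
proof -
  have "strange_term 1 = (\<lambda>n. if n = 0 then 1 else 0)"
    by (auto simp: strange_term_def pochhammer_0_left fun_eq_iff)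
  then have "strange_term 1 sums 1" using sums_single[of 0 "\<lambda>_. 1 :: complex"] by simp
  moreover have "strange_term 1 sums strange_F 1"
    by (rule strange_term_sums) (auto intro!: Re_pos_not_nonpos_Int)
  ultimately show ?thesis by (rule sums_unique2[symmetric])
qed

section \<open>Holomorphy and growth of the series\<close>
lemma holomorphic_pochhammer [holomorphic_intros]:
  "f holomorphic_on A \<Longrightarrow> (\<lambda>z. pochhammer (f z) n) holomorphic_on A"
  unfolding pochhammer_prod by (intro holomorphic_intros)

lemma norm_pochhammer_le:
  fixes z :: complex
  assumes "norm z \<le> r"
  shows "norm (pochhammer z n) \<le> pochhammer r n"
  unfolding pochhammer_prod prod_norm[symmetric]
  by (intro prod_mono) (use assms in \<open>auto intro: order_trans[OF norm_triangle_ineq]\<close>)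

text \<open>
  In this half-plane each factor \<open>1 - z + j\<close> is dominated by the factor \<open>4 * z + 1 / 2 + j\<close> below
  it. What remains is the binomial series of \<open>(1 - 1 / 5) powr (- r)\<close>, which grows along vertical
  lines only like \<open>(5 / 4) powr \<bar>Im z\<bar>\<close>.
\<close>
lemma norm_strange_term_le:
  assumes "Re z \<ge> 1 / 10" "norm (1 / 2 - z) \<le> r"
  shows "norm (strange_term z n) \<le> pochhammer r n / fact n * (1 / 5) ^ n"
proof -
  have factor: "norm (1 - z + of_nat j) \<le> norm (4 * z + 1 / 2 + of_nat j)" for j
  proof (rule power2_le_imp_le)
    have "(1 - Re z + j)\<^sup>2 \<le> (4 * Re z + 1 / 2 + j)\<^sup>2"
      using assms by (intro abs_le_square_iff[THEN iffD1]) auto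
    moreover have "(Im z)\<^sup>2 \<le> (4 * Im z)\<^sup>2" by (simp add: power_mult_distrib)
    ultimately have "(1 - Re z + j)\<^sup>2 + (Im z)\<^sup>2 \<le> (4 * Re z + 1 / 2 + j)\<^sup>2 + (4 * Im z)\<^sup>2"
      by (rule add_mono)
    then show "(norm (1 - z + of_nat j))\<^sup>2 \<le> (norm (4 * z + 1 / 2 + of_nat j))\<^sup>2"
      by (simp add: cmod_power2)
  qed simp
  have "norm (pochhammer (1 - z) n) \<le> norm (pochhammer (4 * z + 1 / 2) n)"
    unfolding pochhammer_prod prod_norm[symmetric] by (intro prod_mono) (use factor in auto)
  then have "norm (pochhammer (1 - z) n) / norm (pochhammer (4 * z + 1 / 2) n) \<le> 1"
    by (simp add: divide_le_eq_1)
  moreover have "norm (pochhammer (1 / 2 - z) n) \<le> pochhammer r n"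
    by (rule norm_pochhammer_le) fact
  ultimately have "norm (pochhammer (1 - z) n) / norm (pochhammer (4 * z + 1 / 2) n)
      * (norm (pochhammer (1 / 2 - z) n) / fact n * (1 / 5) ^ n)
      \<le> 1 * (pochhammer r n / fact n * (1 / 5) ^ n)"
    by (intro mult_mono divide_right_mono mult_right_mono) auto
  then show ?thesis
    by (simp add: strange_term_def norm_mult norm_divide norm_power pochhammer_fact[symmetric])
qed

lemma binomial_majorant_sums:
  "(\<lambda>n. pochhammer r n / fact n * (1 / 5) ^ n) sums (4 / 5) powr (- r :: real)"
proof -
  have "(\<lambda>n. (- r gchoose n) * (- 1 / 5) ^ n) sums (1 + - 1 / 5) powr (- r)"
    by (rule gen_binomial_real) simp
  moreover have "(- r gchoose n) * (- 1 / 5) ^ n = pochhammer r n / fact n * (1 / 5) ^ n" for n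
  proof -
    have "(- 1) ^ n * (- 1 / 5) ^ n = (1 / 5 :: real) ^ n" by (simp flip: power_mult_distrib)
    then show ?thesis by (simp add: gbinomial_pochhammer)
  qed
  ultimately show ?thesis by simp
qed

lemma norm_strange_F_le:
  assumes "Re z \<ge> 1 / 10"
  shows "norm (strange_F z) \<le> (4 / 5) powr (- norm (1 / 2 - z))"
proof -
  have "strange_F z = suminf (strange_term z)"
    using assms by (intro sums_unique strange_term_sums Re_pos_not_nonpos_Int) simp
  moreover have "norm (suminf (strange_term z)) \<le> (\<Sum>n. pochhammer (norm (1 / 2 - z)) n / fact n * (1 / 5) ^ n)"
    by (intro norm_suminf_le norm_strange_term_le sums_summable[OF binomial_majorant_sums] assms) simp
  ultimately show ?thesis using sums_unique[OF binomial_majorant_sums] by simp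
qed

lemma holomorphic_strange_F: "strange_F holomorphic_on {z. Re z > 1 / 10}"
proof (rule holomorphic_uniform_sequence)
  show "open {z. Re z > 1 / 10}" by (rule open_halfspace_Re_gt)
  have nz: "pochhammer (4 * z + 1 / 2) n \<noteq> 0" if "Re z > 1 / 10" for z n
    using that pochhammer_eq_0_imp_nonpos_Int[of "4 * z + 1 / 2" n] Re_pos_not_nonpos_Int[of "4 * z + 1 / 2"] by auto
  show "(\<lambda>z. \<Sum>i<n. strange_term z i) holomorphic_on {z. Re z > 1 / 10}" for n
    unfolding strange_term_def by (intro holomorphic_intros) (auto simp: nz pochhammer_fact[symmetric])
  fix x :: complex
  assume x: "x \<in> {z. Re z > 1 / 10}"
  define d where "d = (Re x - 1 / 10) / 2"
  define r where "r = norm (1 / 2 - x) + d"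
  have sub: "cball x d \<subseteq> {z. Re z > 1 / 10}"
  proof
    fix y assume "y \<in> cball x d"
    then have "Re x - Re y \<le> d"
      using complex_Re_le_cmod[of "x - y"] by (simp add: dist_norm)
    then show "y \<in> {z. Re z > 1 / 10}" using x by (simp add: d_def)
  qed
  have "uniform_limit (cball x d) (\<lambda>n z. \<Sum>i<n. strange_term z i) (\<lambda>z. suminf (strange_term z)) sequentially"
  proof (rule Weierstrass_m_test)
    show "summable (\<lambda>n. pochhammer r n / fact n * (1 / 5) ^ n)"
      by (rule sums_summable[OF binomial_majorant_sums])
    fix n y assume y: "y \<in> cball x d"
    have "norm (1 / 2 - y) \<le> norm (1 / 2 - x) + norm (x - y)"
      using norm_triangle_ineq[of "1 / 2 - x" "x - y"] by simp
    then have "norm (1 / 2 - y) \<le> r" using y by (simp add: r_def dist_norm)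
    then show "norm (strange_term y n) \<le> pochhammer r n / fact n * (1 / 5) ^ n"
      using y sub by (intro norm_strange_term_le) auto
  qed
  moreover have "suminf (strange_term z) = strange_F z" if "z \<in> cball x d" for z
  proof (rule sums_unique[symmetric, OF strange_term_sums])
    have "Re z > 1 / 10" using sub that by blast
    then show "4 * z + 1 / 2 \<notin> \<int>\<^sub>\<le>\<^sub>0" by (intro Re_pos_not_nonpos_Int) simp
  qed
  ultimately have "uniform_limit (cball x d) (\<lambda>n z. \<Sum>i<n. strange_term z i) strange_F sequentially"
    by (subst (asm) uniform_limit_cong'[OF refl]) auto
  then show "\<exists>d>0. cball x d \<subseteq> {z. Re z > 1 / 10} \<and>
      uniform_limit (cball x d) (\<lambda>n z. \<Sum>i<n. strange_term z i) strange_F sequentially"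
    using sub x by (intro exI[of _ d]) (auto simp: d_def)
qed

lemma holomorphic_closed_form: "closed_form holomorphic_on {z. Re z > 1 / 10}"
  unfolding closed_form_def
  by (intro holomorphic_intros) (auto simp: Gamma_eq_zero_iff intro!: Re_pos_not_nonpos_Int)

section \<open>Growth of the closed form\<close>

text \<open>
  By the duplication formula \<open>Gamma (4 * z + 1 / 2)\<close> is, up to elementary factors, the product of
  \<open>Gamma (2 * z + 1 / 4)\<close> and \<open>Gamma (2 * z + 3 / 4)\<close>. Pairing these with
  \<open>Gamma (2 * z + 2 / 5)\<close> and \<open>Gamma (2 * z + 3 / 5)\<close> leaves two ratios with real shifts, so the
  exponential decay cancels. The first shift has the wrong sign for \<open>norm_Gamma_ratio_le\<close>; passing
  to \<open>Gamma (2 * z + 5 / 4)\<close> repairs this at the price of a linear factor, which \<open>exp \<bar>Im z\<bar>\<close>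
  absorbs.
\<close>
lemma norm_inverse_closed_form_le:
  obtains C where "C \<ge> 0"
    "\<And>z. 1 \<le> Re z \<Longrightarrow> Re z \<le> 2 \<Longrightarrow> norm (inverse (closed_form z)) \<le> C * exp \<bar>Im z\<bar>"
proof -
  define K where "K = norm (Gamma (5 / 2) / (Gamma (7 / 5) * Gamma (8 / 5)) :: complex)"
  \<comment> \<open>The constants of all estimates on the line \<open>Re z = s\<close>; continuity in \<open>s\<close> makes them uniform.\<close>
  define \<phi> :: "real \<Rightarrow> real" where "\<phi> = (\<lambda>s. K * 5 powr (6 * s - 3) / 2 powr (10 * s - 5)
    * (exp ((1 - 2 * (2 * s + 1 / 4)) * ln 2) * sqrt pi)
    * (5 * (Gamma (2 * s + 2 / 5) / Gamma (2 * s + 5 / 4)) * (Gamma (2 * s + 3 / 5) / Gamma (2 * s + 3 / 4))))"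
  have not_pole: "x \<notin> \<int>\<^sub>\<le>\<^sub>0" if "x > 0" for x :: real
    using nonpos_Ints_nonpos[of x] that by linarith
  have Gamma_cont: "continuous_on {1..2} (\<lambda>s. Gamma (2 * s + c))" if "c > 0" for c :: real
  proof (rule continuous_on_compose2[OF continuous_on_Gamma])
    show "{0<..} \<inter> \<int>\<^sub>\<le>\<^sub>0 = ({} :: real set)" using not_pole by auto
  qed (use that in \<open>auto intro!: continuous_intros\<close>)
  have "continuous_on {1..2} \<phi>"
    unfolding \<phi>_def by (intro continuous_on_mult continuous_on_divide continuous_on_powr continuous_on_exp
      continuous_on_const continuous_on_diff continuous_on_add continuous_on_id Gamma_cont ballI)
      (simp_all add: Gamma_eq_zero_iff not_pole)
  then obtain C where C: "\<And>s. s \<in> {1..2} \<Longrightarrow> \<bar>\<phi> s\<bar> \<le> C"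
    using compact_imp_bounded[OF compact_continuous_image[OF _ compact_Icc]]
    by (metis bounded_iff image_eqI real_norm_def)
  have "norm (inverse (closed_form z)) \<le> \<phi> (Re z) * exp \<bar>Im z\<bar>" if z: "1 \<le> Re z" "Re z \<le> 2" for z
  proof -
    define s where "s = Re z"
    define w where "w = 2 * z + 1 / 4"
    have G0: "Gamma w \<noteq> 0" "Gamma (w + 1 / 2) \<noteq> 0" "Gamma (4 * z + 1 / 2) \<noteq> 0"
      using z by (auto simp: w_def Gamma_eq_zero_iff intro!: Re_pos_not_nonpos_Int)
    have pos: "Gamma (2 * s + 2 / 5) > 0" "Gamma (2 * s + 3 / 5) > 0" "Gamma (2 * s + 5 / 4) > 0" "Gamma (2 * s + 3 / 4) > 0"
      using z by (auto simp: s_def intro!: Gamma_real_pos)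
    define E where "E = exp ((1 - 2 * (2 * s + 1 / 4)) * ln 2) * sqrt pi"
    have "2 * w = 4 * z + 1 / 2" by (simp add: w_def)
    then have eq: "Gamma w * Gamma (w + 1 / 2)
        = exp ((1 - 2 * w) * of_real (ln 2)) * of_real (sqrt pi) * Gamma (4 * z + 1 / 2)"
      using Gamma_legendre_duplication[of w] z
        Re_pos_not_nonpos_Int[of w] Re_pos_not_nonpos_Int[of "w + 1 / 2"] by (simp add: w_def)
    have dup: "norm (Gamma w) * norm (Gamma (w + 1 / 2)) = E * norm (Gamma (4 * z + 1 / 2))"
      unfolding norm_mult[symmetric] eq by (simp add: norm_mult E_def w_def s_def)
    have w1: "Gamma (w + 1) = w * Gamma w"
      using z by (intro Gamma_plus1 Re_pos_not_nonpos_Int) (simp add: w_def)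
    have "norm w \<le> 5 + 2 * \<bar>Im z\<bar>"
      using cmod_le[of w] z by (simp add: w_def)
    also have "\<dots> \<le> 5 * exp \<bar>Im z\<bar>"
      using exp_ge_add_one_self[of "\<bar>Im z\<bar>"] abs_ge_zero[of "Im z"] by linarith
    finally have nw: "norm w \<le> 5 * exp \<bar>Im z\<bar>" .
    have "norm (Gamma (2 * z + 2 / 5)) * Gamma (Re (w + 1)) \<le> Gamma (Re (2 * z + 2 / 5)) * norm (Gamma (w + 1))"
      using z by (intro norm_Gamma_ratio_le) (auto simp: w_def)
    then have g1: "norm (Gamma (2 * z + 2 / 5)) / norm (Gamma w)
        \<le> norm w * (Gamma (2 * s + 2 / 5) / Gamma (2 * s + 5 / 4))"
      using G0 pos unfolding w1 norm_mult by (simp add: w_def s_def field_simps)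
    have "norm (Gamma (2 * z + 3 / 5)) * Gamma (Re (w + 1 / 2)) \<le> Gamma (Re (2 * z + 3 / 5)) * norm (Gamma (w + 1 / 2))"
      using z by (intro norm_Gamma_ratio_le) (auto simp: w_def)
    then have g2: "norm (Gamma (2 * z + 3 / 5)) / norm (Gamma (w + 1 / 2))
        \<le> Gamma (2 * s + 3 / 5) / Gamma (2 * s + 3 / 4)"
      using G0 pos by (simp add: w_def s_def field_simps)
    have "norm (Gamma (2 * z + 2 / 5)) / norm (Gamma w) * (norm (Gamma (2 * z + 3 / 5)) / norm (Gamma (w + 1 / 2)))
       \<le> (norm w * (Gamma (2 * s + 2 / 5) / Gamma (2 * s + 5 / 4))) * (Gamma (2 * s + 3 / 5) / Gamma (2 * s + 3 / 4))"
      using pos by (intro mult_mono g1 g2) auto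
    also have "\<dots> \<le> (5 * exp \<bar>Im z\<bar> * (Gamma (2 * s + 2 / 5) / Gamma (2 * s + 5 / 4))) * (Gamma (2 * s + 3 / 5) / Gamma (2 * s + 3 / 4))"
      using pos nw by (intro mult_right_mono) auto
    finally have g: "norm (Gamma (2 * z + 2 / 5)) / norm (Gamma w) * (norm (Gamma (2 * z + 3 / 5)) / norm (Gamma (w + 1 / 2)))
       \<le> 5 * (Gamma (2 * s + 2 / 5) / Gamma (2 * s + 5 / 4)) * (Gamma (2 * s + 3 / 5) / Gamma (2 * s + 3 / 4)) * exp \<bar>Im z\<bar>"
      by (simp add: mult_ac)
    have p: "norm (5 powr (6 * z - 3)) = 5 powr (6 * s - 3)" "norm (2 powr (10 * z - 5)) = 2 powr (10 * s - 5)"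
      by (simp_all add: norm_powr_real_powr s_def)
    have "norm (inverse (closed_form z)) = K * 5 powr (6 * s - 3) / 2 powr (10 * s - 5)
       * (norm (Gamma (2 * z + 2 / 5)) * norm (Gamma (2 * z + 3 / 5)) / norm (Gamma (4 * z + 1 / 2)))"
      unfolding closed_form_def K_def rGamma_inverse_Gamma norm_inverse norm_mult norm_divide p
      by (simp add: field_simps)
    also have "norm (Gamma (2 * z + 2 / 5)) * norm (Gamma (2 * z + 3 / 5)) / norm (Gamma (4 * z + 1 / 2))
       = E * (norm (Gamma (2 * z + 2 / 5)) / norm (Gamma w) * (norm (Gamma (2 * z + 3 / 5)) / norm (Gamma (w + 1 / 2))))"
      using dup G0 by (simp add: E_def divide_simps)
    also have "K * 5 powr (6 * s - 3) / 2 powr (10 * s - 5) * \<dots> \<le> K * 5 powr (6 * s - 3) / 2 powr (10 * s - 5) *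
       (E * (5 * (Gamma (2 * s + 2 / 5) / Gamma (2 * s + 5 / 4)) * (Gamma (2 * s + 3 / 5) / Gamma (2 * s + 3 / 4)) * exp \<bar>Im z\<bar>))"
      by (intro mult_left_mono g) (auto simp: E_def K_def)
    also have "\<dots> = \<phi> (Re z) * exp \<bar>Im z\<bar>"
      by (simp add: \<phi>_def E_def s_def)
    finally show ?thesis .
  qed
  moreover have "\<phi> (Re z) * exp \<bar>Im z\<bar> \<le> C * exp \<bar>Im z\<bar>" if "1 \<le> Re z" "Re z \<le> 2" for z
    using C[of "Re z"] that by (intro mult_right_mono) auto
  ultimately have "norm (inverse (closed_form z)) \<le> C * exp \<bar>Im z\<bar>" if "1 \<le> Re z" "Re z \<le> 2" for z
    using that by (meson order_trans)
  moreover have "C \<ge> 0" using C[of 1] by simp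
  ultimately show ?thesis using that by blast
qed

section \<open>The evaluation\<close>

text \<open>
  The quotient of the two sides is holomorphic here, as the closed form has no zeros in this
  half-plane, and it has period \<open>1\<close> by the common recurrence. On the strip
  \<open>1 \<le> Re z \<le> 2\<close> its growth rate is at most \<open>1 / 4 + 1 < pi\<close>: the first summand bounds
  \<open>ln (5 / 4)\<close>, from the series, and the second comes from the closed form. Hence it is
  constant, and its value at \<open>1\<close> is \<open>1\<close>, where the series reduces to its first term.
\<close>
lemma strange_F_eq_closed_form_right:
  assumes a: "Re a > 1 / 10"
  shows "strange_F a = closed_form a"
proof -
  define W where "W = (\<lambda>z. strange_F z / closed_form z)"
  have "W holomorphic_on {z. Re z > 1 / 10}"
    unfolding W_def
    by (intro holomorphic_on_divide holomorphic_strange_F holomorphic_closed_form) (simp add: closed_form_nonzero)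
  moreover have "W (z + 1) = W z" if z: "Re z > 1 / 10" for z
  proof -
    have c: "4 * z + 1 / 2 \<notin> \<int>\<^sub>\<le>\<^sub>0" using z by (intro Re_pos_not_nonpos_Int) simp
    have nz: "closed_form z \<noteq> 0" "closed_form (z + 1) \<noteq> 0" using z by (auto intro!: closed_form_nonzero)
    define A where "A = 5 ^ 6 * shift_factor z"
    define B where "B = 2 ^ 10 * pochhammer (4 * z + 1 / 2) 4"
    have "B \<noteq> 0" using pochhammer_eq_0_imp_nonpos_Int[of "4 * z + 1 / 2" 4] c by (auto simp: B_def)
    have F: "A * strange_F (z + 1) = B * strange_F z" and R: "A * closed_form (z + 1) = B * closed_form z"
      unfolding A_def B_def by (rule strange_F_recurrence closed_form_recurrence, fact c)+
    have "A \<noteq> 0" using R nz \<open>B \<noteq> 0\<close> by auto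
    have "W (z + 1) = (A * strange_F (z + 1)) / (A * closed_form (z + 1))"
      using \<open>A \<noteq> 0\<close> by (simp add: W_def)
    also have "\<dots> = W z" unfolding F R using \<open>B \<noteq> 0\<close> by (simp add: W_def)
    finally show ?thesis .
  qed
  ultimately obtain g where g: "g holomorphic_on UNIV" "\<And>z. g (z + 1) = g z"
    "\<And>z. Re z > 1 / 10 \<Longrightarrow> g z = W z"
    by (rule periodic_half_plane_extension[where f = W]) auto
  obtain C where C: "C \<ge> 0" "\<And>z. 1 \<le> Re z \<Longrightarrow> Re z \<le> 2 \<Longrightarrow> norm (inverse (closed_form z)) \<le> C * exp \<bar>Im z\<bar>"
    using norm_inverse_closed_form_le by blast
  have "norm (g z) \<le> exp (3 / 8) * C * exp (5 / 4 * \<bar>Im z\<bar>)" for z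
  proof -
    define w where "w = z + of_int (1 - \<lfloor>Re z\<rfloor>)"
    have w: "1 \<le> Re w" "Re w \<le> 2" "Im w = Im z" unfolding w_def by (simp_all, linarith+)
    have "norm (1 / 2 - w) \<le> 3 / 2 + \<bar>Im z\<bar>" using cmod_le[of "1 / 2 - w"] w by simp
    moreover have "ln (5 / 4 :: real) \<le> 1 / 4" using ln_le_minus_one[of "5 / 4 :: real"] by simp
    ultimately have "norm (1 / 2 - w) * ln (5 / 4) \<le> (3 / 2 + \<bar>Im z\<bar>) * (1 / 4)"
      by (intro mult_mono) auto
    then have "(4 / 5) powr (- norm (1 / 2 - w)) \<le> exp (3 / 8 + \<bar>Im z\<bar> / 4)"
      by (simp add: powr_def ln_div algebra_simps)
    moreover have "norm (strange_F w) \<le> (4 / 5) powr (- norm (1 / 2 - w))"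
      using w by (intro norm_strange_F_le) simp
    ultimately have "norm (strange_F w) * norm (inverse (closed_form w)) \<le> exp (3 / 8 + \<bar>Im z\<bar> / 4) * (C * exp \<bar>Im z\<bar>)"
      using C(2)[of w] w by (intro mult_mono) auto
    also have "\<dots> = exp (3 / 8) * C * exp (5 / 4 * \<bar>Im z\<bar>)"
    proof -
      have "exp (5 / 4 * \<bar>Im z\<bar>) = exp (\<bar>Im z\<bar> / 4) * exp \<bar>Im z\<bar>" by (simp flip: exp_add)
      then show ?thesis by (simp add: exp_add)
    qed
    finally have "norm (W w) \<le> exp (3 / 8) * C * exp (5 / 4 * \<bar>Im z\<bar>)"
      by (simp only: W_def norm_mult divide_inverse)
    moreover have "g z = W w"
    proof -
      have "g w = g z" unfolding w_def by (rule periodic_of_int[where f = g, OF g(2)])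
      then show ?thesis using g(3)[of w] w by simp
    qed
    ultimately show ?thesis by simp
  qed
  then have "g a = g 0" "g 1 = g 0"
    by (rule periodic_entire_small_growth_constant[OF g(1,2)]; use pi_gt3 in simp)+
  then have "W a = W 1" using g(3)[of a] g(3)[of 1] a by simp
  then show ?thesis
    using closed_form_nonzero[OF a] by (simp add: W_def strange_F_1 closed_form_1)
qed

text \<open>
  The recurrence determines the value at \<open>a\<close> from the value at \<open>a + 1\<close>, because its factor
  \<open>pochhammer (4 * a + 1 / 2) 4\<close> is nonzero as long as \<open>4 * a + 1 / 2\<close> is admissible.
\<close>
lemma strange_F_eq_closed_form:
  assumes "4 * a + 1 / 2 \<notin> \<int>\<^sub>\<le>\<^sub>0" "Re a + real n > 1 / 10"
  shows "strange_F a = closed_form a"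
  using assms
proof (induction n arbitrary: a)
  case 0
  then show ?case by (simp add: strange_F_eq_closed_form_right)
next
  case (Suc n)
  have "4 * (a + 1) + 1 / 2 \<notin> \<int>\<^sub>\<le>\<^sub>0"
    using Suc.prems(1) nonpos_Ints_diff_Nats[of "4 * (a + 1) + 1 / 2" 4] by (auto simp: algebra_simps)
  then have "strange_F (a + 1) = closed_form (a + 1)"
    using Suc.prems(2) by (intro Suc.IH) auto
  then have "2 ^ 10 * pochhammer (4 * a + 1 / 2) 4 * strange_F a
      = 2 ^ 10 * pochhammer (4 * a + 1 / 2) 4 * closed_form a"
    unfolding strange_F_recurrence[OF Suc.prems(1), symmetric] closed_form_recurrence[OF Suc.prems(1), symmetric] by simp
  moreover have "pochhammer (4 * a + 1 / 2) 4 \<noteq> 0"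
    using Suc.prems(1) pochhammer_eq_0_imp_nonpos_Int by blast
  ultimately show ?case by simp
qed

theorem mainTheorem11:
  fixes a :: complex
  assumes "4 * a + 1 / 2 \<notin> \<int>\<^sub>\<le>\<^sub>0"
  shows "gauss_F (1 - a) (1 / 2 - a) (4 * a + 1 / 2) (1 / 5) =
    (2 powr (10 * a - 5) * Gamma (7 / 5) * Gamma (8 / 5) * Gamma (4 * a + 1 / 2)) /
      (5 powr (6 * a - 3) * Gamma (5 / 2)) *
    rGamma (2 * a + 2 / 5) * rGamma (2 * a + 3 / 5)"
proof -
  obtain n :: nat where "1 / 10 - Re a < real n" using reals_Archimedean2 by blast
  then show ?thesis
    using strange_F_eq_closed_form[OF assms, of n] by (simp add: strange_F_def closed_form_def)
qed

end
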